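(* Let $a$ and $b$ be positive integers with $a>b$, let $\beta$ be an integer, and let $p$ be a prime not dividing $a$. Then there are infinitely many positive integers $n$ such that $\binom{an}{bn+\beta}\equiv \pm 1 \pmod p$. *)

theory Defs
  imports "HOL-Number_Theory.Number_Theory"
begin

text \<open>
  Binomial coefficient whose lower index is an arbitrary integer, with the usual convention that
  it vanishes for a negative lower index (and, through \<^const>\<open>binomial\<close>, for one exceeding the
  upper index). The case distinction is needed because \<^const>\<open>nat\<close> truncates negative
  integers to \<open>0\<close>.
\<close>

definition binomial_int :: "nat \<Rightarrow> int \<Rightarrow> int" where
  "binomial_int m k = (if k < 0 then 0 else int (m choose nat k))"

end

theory Submission
  imports Defs
begin

text \<open>
  For a power \<open>q\<close> of \<open>p\<close>, the inner entries of row \<open>q\<close> of Pascal's triangle vanish modulo \<open>p\<close>, so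
  row \<open>q - 1\<close> is \<open>1, -1, 1, \<dots>\<close>. As \<open>p\<close> is coprime to \<open>a\<close>, Euler's theorem provides arbitrarily
  large \<open>q\<close> with \<open>q - 1 = a * n\<close>. Because \<open>0 < b < a\<close>, the index \<open>b * n + \<beta>\<close> lies in that row as
  soon as \<open>n \<ge> \<bar>\<beta>\<bar>\<close>.
\<close>

text \<open>By absorption, \<open>j * (p ^ k choose j)\<close> is a multiple of
  \<open>p ^ k\<close>; were the binomial prime to \<open>p\<close>, all of \<open>p ^ k\<close>
  would divide the smaller positive number \<open>j\<close>.\<close>

lemma prime_dvd_prime_power_choose:
  fixes p k j :: nat
  assumes "prime p" "0 < j" "j < p ^ k"
  shows "p dvd (p ^ k choose j)"
proof (rule ccontr)
  assume "\<not> p dvd (p ^ k choose j)"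
  then have "coprime (p ^ k) (p ^ k choose j)"
    using assms(1) by (simp add: prime_imp_coprime)
  moreover have "p ^ k dvd j * (p ^ k choose j)"
    using assms by (simp add: times_binomial_minus1_eq)
  ultimately have "p ^ k dvd j"
    by (simp add: coprime_dvd_mult_left_iff)
  with assms show False
    by (auto dest: dvd_imp_le)
qed

lemma prime_power_minus_one_choose_cong:
  fixes p k j :: nat
  assumes "prime p" "j < p ^ k"
  shows "[int (p ^ k - 1 choose j) = (- 1) ^ j] (mod int p)"
  using assms(2)
proof (induction j)
  case 0
  then show ?case by simp
next
  case (Suc j)
  have "p ^ k choose Suc j = (p ^ k - 1 choose j) + (p ^ k - 1 choose Suc j)"
    using Suc.prems by (cases "p ^ k") auto
  moreover have "int p dvd int (p ^ k choose Suc j)"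
    using prime_dvd_prime_power_choose[OF assms(1) _ Suc.prems] by simp
  ultimately have "[int (p ^ k - 1 choose Suc j) = - int (p ^ k - 1 choose j)] (mod int p)"
    by (simp add: cong_iff_dvd_diff add.commute)
  also have "[- int (p ^ k - 1 choose j) = - ((- 1) ^ j)] (mod int p)"
    using Suc by (simp add: cong_minus_minus_iff)
  finally show ?case by simp
qed

theorem theorem2p2:
  fixes a b p :: nat and \<beta> :: int
  assumes "b > 0" and "a > b" and "prime p" and "\<not> p dvd a"
  shows "infinite {n :: nat. n > 0 \<and>
           ([binomial_int (a * n) (int b * int n + \<beta>) = 1] (mod int p) \<or>
            [binomial_int (a * n) (int b * int n + \<beta>) = - 1] (mod int p))}"
  unfolding infinite_nat_iff_unbounded
proof
  fix N :: nat
  \<comment> \<open>The factor \<open>totient a\<close> in \<open>k\<close> serves Euler's theorem;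
    \<open>m\<close> serves size, since \<open>a * n = p ^ k - 1 \<ge> k \<ge> m\<close> forces
    \<open>n > N + \<bar>\<beta>\<bar>\<close>.\<close>
  define m where "m = a * (N + nat \<bar>\<beta>\<bar> + 1)"
  define k where "k = totient a * m"
  have "coprime p a"
    using assms by (simp add: prime_imp_coprime)
  then have "[(p ^ totient a) ^ m = 1 ^ m] (mod a)"
    by (intro cong_pow euler_theorem)
  then have "a dvd p ^ k - 1"
    unfolding k_def power_mult by (intro cong_to_1_nat) simp
  then obtain n where n: "p ^ k - 1 = a * n" ..
  have "m \<le> k"
    using assms(2) by (simp add: k_def Suc_le_eq)
  also have "k < p ^ k"
    using prime_gt_1_nat[OF assms(3)] by (simp add: power_gt_expt)
  finally have "a * (N + nat \<bar>\<beta>\<bar> + 1) \<le> a * n"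
    unfolding n[symmetric] m_def by simp
  then have n_ge: "N + nat \<bar>\<beta>\<bar> + 1 \<le> n"
    using assms(2) unfolding mult_le_cancel1 by simp
  define j where "j = nat (int b * int n + \<beta>)"
  \<comment> \<open>With \<open>n > \<bar>\<beta>\<bar>\<close> this makes the lower index positive,
    so \<open>nat\<close> truncates nothing.\<close>
  have "int n \<le> int b * int n"
    using assms(1) by (simp flip: of_nat_mult)
  then have j: "int j = int b * int n + \<beta>"
    using n_ge unfolding j_def by linarith
  \<comment> \<open>The gap \<open>a - b \<ge> 1\<close> leaves room for the shift:
    \<open>b * n + \<beta> \<le> (b + 1) * n \<le> a * n\<close>.\<close>
  have "int (b + 1) * int n \<le> int a * int n"
    using assms(2) by (intro mult_right_mono) auto
  then have "int j \<le> int (a * n)"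
    using n_ge by (simp add: j algebra_simps)
  then have "j < p ^ k"
    using n \<open>k < p ^ k\<close> by linarith
  then have "[binomial_int (a * n) (int b * int n + \<beta>) = (- 1) ^ j] (mod int p)"
    using prime_power_minus_one_choose_cong[OF assms(3), of j k]
    by (simp add: binomial_int_def flip: j n)
  then show "\<exists>n>N. n \<in> {n. n > 0 \<and>
           ([binomial_int (a * n) (int b * int n + \<beta>) = 1] (mod int p) \<or>
            [binomial_int (a * n) (int b * int n + \<beta>) = - 1] (mod int p))}"
    using n_ge by (intro exI[of _ n]) (cases "even j"; simp)
qed

end
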